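(* Let $\Sigma_D:=\frac1K P^\top P\in\mathbb{R}^{(N-1)\times(N-1)}$ be the empirical information matrix of the dataset $D$. If $\Sigma_D$ has full rank, i.e. $\mathrm{rank}(\Sigma_D)=\mathrm{rank}(P)=N-1$, and the optimal $\gamma^*$ in the convex program $(\mathrm{P})$ satisfies $\gamma^*>0$, then $(\hat u_{\rm MLE},\hat\sigma_{\rm MLE})$ is the unique optimal solution of $$\max_{u_N\in\mathcal{U}_N,\ \sigma\ge1/\bar c}\ \ell(u_N,\sigma).$$
   Context: Fix constants $\bar b>0$, $L>0$, $\bar c>0$. $\mathcal{U}_c$ is the set of all functions $u:[0,\bar b]\to\mathbb{R}$ that are monotonically increasing (in the weak sense, i.e. nondecreasing), concave, Lipschitz continuous with modulus at most $L$, and satisfy $u(0)=0$, $u(\bar b)=1$. A dataset $D=\{(W_k,Y_k,Z_k): k=1,\dots,K\}$ is given, where $W_k,Y_k$ are random variables (lotteries) with finite support contained in $[0,\bar b]$ and $Z_k\in\{1,-1\}$. Let $\mathbb{Y}=\{y_1<\dots<y_N\}$ be the ordered list of all points of $\{0,\bar b\}\cup\bigcup_k \mathrm{supp}(W_k)\cup\bigcup_k\mathrm{supp}(Y_k)$, so $y_1=0$, $y_N=\bar b$. Put $p^k_j=\mathbb{P}[W_k=y_j]-\mathbb{P}[Y_k=y_j]$, $p^k_{2:N}=(p^k_2,\dots,p^k_N)^\top$, and let $P\in\mathbb{R}^{K\times(N-1)}$ be the matrix whose $k$-th row is $(p^k_{2:N})^\top$. The log-likelihood, for $u\in\mathcal{U}_c$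 and real $\sigma\ge 1/\bar c$, is $$\ell(u,\sigma)=-\sum_{k=1}^K\log\Big[1+\exp\Big(\frac{\sum_{j=1}^N -Z_kp^k_j\,u(y_j)}{\sigma}\Big)\Big].$$ $\mathcal{U}_N=\{\mathcal{T}u:u\in\mathcal{U}_c\}$, where $\mathcal{T}u$ is the continuous piecewise-linear function on $[0,\bar b]$ that is affine on each $[y_j,y_{j+1}]$ and agrees with $u$ at every $y_j$. Program $(\mathrm{P})$: maximize $-\sum_{k=1}^K\log\big[1+\exp\big(\sum_{j=1}^N -Z_kp^k_j\bar\alpha_j\big)\big]$ over $\bar\alpha\in\mathbb{R}^N$, $\bar\beta\in\mathbb{R}^{N-1}$, $\gamma\in[0,\bar c]$ subject to $\bar\beta_j=(\bar\alpha_{j+1}-\bar\alpha_j)/(y_{j+1}-y_j)$ for $j=1,\dots,N-1$; $\bar\beta_{j+1}\le\bar\beta_j$ for $j=1,\dots,N-2$; $\bar\beta_1\le L\gamma$; $\bar\beta_{N-1}\ge0$; $\bar\alpha_1=0$; $\bar\alpha_N=\gamma$. Let $(\bar\alpha^*,\bar\beta^*,\gamma^* )$ be an optimal solution. When $\gamma^*>0$, set $\hat\alpha^{\rm MLE}=\bar\alpha^*/\gamma^*$, $\hat\beta^{\rm MLE}=\bar\beta^*/\gamma^*$, $\hat\sigma_{\rm MLE}=1/\gamma^*$, and let $\hat u_{\rm MLE}$ be the function with $\hat u_{\rm MLE}(y)=\hat\beta^{\rm MLE}_j(y-y_j)+\hat\alpha^{\rm MLE}_j$ for $y_j\le y<y_{j+1}$,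 $j=1,\dots,N-1$, and $\hat u_{\rm MLE}(\bar b)=1$. *)

theory Defs
  imports "HOL-Probability.Probability_Mass_Function" "Jordan_Normal_Form.DL_Rank"
begin

section \<open>Utility functions\<close>

text \<open>
  A function on \<open>[0, b]\<close> is encoded as a total function that is \<^const>\<open>extensional\<close> on
  \<open>{0..b}\<close>, so that equality of such functions is equality on \<open>[0, b]\<close>.
\<close>

definition utilities :: "real \<Rightarrow> real \<Rightarrow> (real \<Rightarrow> real) set" where
  "utilities b L = {u \<in> extensional {0..b}.
     mono_on {0..b} u \<and> concave_on {0..b} u \<and> L-lipschitz_on {0..b} u \<and> u 0 = 0 \<and> u b = 1}"

section \<open>Datasets\<close>

text \<open>
  Only the laws of the two lotteries of an observation matter, so lotteries are probability mass
  functions: \<open>pmf (lotW d) y\<close> is the probability that \<open>W\<close> takes the value \<open>y\<close>. A dataset is a list,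
  since observations may be repeated. Its \<open>k\<close>-th observation (\<open>k = 1, \<dots>, K\<close>) is \<open>D ! (k - 1)\<close>.
\<close>

record observation =
  lotW :: "real pmf"
  lotY :: "real pmf"
  outcome :: real

definition valid_dataset :: "real \<Rightarrow> observation list \<Rightarrow> bool" where
  "valid_dataset b D \<longleftrightarrow> (\<forall>d \<in> set D.
     finite (set_pmf (lotW d)) \<and> set_pmf (lotW d) \<subseteq> {0..b} \<and>
     finite (set_pmf (lotY d)) \<and> set_pmf (lotY d) \<subseteq> {0..b} \<and>
     outcome d \<in> {1, -1})"

definition points :: "real \<Rightarrow> observation list \<Rightarrow> real set" where
  "points b D = {0, b} \<union> (\<Union>d\<in>set D. set_pmf (lotW d)) \<union> (\<Union>d\<in>set D. set_pmf (lotY d))"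

definition num_points :: "real \<Rightarrow> observation list \<Rightarrow> nat" where
  "num_points b D = card (points b D)"

text \<open>\<open>point b D j\<close> is \<open>y\<^sub>j\<close> for \<open>j = 1, \<dots>, N\<close>.\<close>

definition point :: "real \<Rightarrow> observation list \<Rightarrow> nat \<Rightarrow> real" where
  "point b D j = sorted_list_of_set (points b D) ! (j - 1)"

definition prob_diff :: "real \<Rightarrow> observation list \<Rightarrow> nat \<Rightarrow> nat \<Rightarrow> real" where
  "prob_diff b D k j =
     pmf (lotW (D ! (k - 1))) (point b D j) - pmf (lotY (D ! (k - 1))) (point b D j)"

text \<open>
  Matrix entries are indexed from \<open>0\<close>, so entry \<open>(i, j)\<close> belongs to observation \<open>i + 1\<close> and
  to the point \<open>y\<^sub>j\<^sub>+\<^sub>2\<close>.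
\<close>

definition design_matrix :: "real \<Rightarrow> observation list \<Rightarrow> real mat" where
  "design_matrix b D =
     mat (length D) (num_points b D - 1) (\<lambda>(i, j). prob_diff b D (i + 1) (j + 2))"

definition information_matrix :: "real \<Rightarrow> observation list \<Rightarrow> real mat" where
  "information_matrix b D =
     (1 / real (length D)) \<cdot>\<^sub>m (transpose_mat (design_matrix b D) * design_matrix b D)"

definition log_likelihood :: "real \<Rightarrow> observation list \<Rightarrow> (real \<Rightarrow> real) \<Rightarrow> real \<Rightarrow> real" where
  "log_likelihood b D u \<sigma> =
     - (\<Sum>k=1..length D. ln (1 + exp ((\<Sum>j=1..num_points b D.
          - outcome (D ! (k - 1)) * prob_diff b D k j * u (point b D j)) / \<sigma>)))"

section \<open>Piecewise linear interpolation\<close>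

definition is_interpolant ::
  "real \<Rightarrow> observation list \<Rightarrow> (real \<Rightarrow> real) \<Rightarrow> (real \<Rightarrow> real) \<Rightarrow> bool" where
  "is_interpolant b D u v \<longleftrightarrow>
     v \<in> extensional {0..b} \<and> continuous_on {0..b} v \<and>
     (\<forall>j\<in>{1..<num_points b D}. \<exists>m c. \<forall>x\<in>{point b D j..point b D (j + 1)}. v x = m * x + c) \<and>
     (\<forall>j\<in>{1..num_points b D}. v (point b D j) = u (point b D j))"

definition interpolant :: "real \<Rightarrow> observation list \<Rightarrow> (real \<Rightarrow> real) \<Rightarrow> real \<Rightarrow> real" where
  "interpolant b D u = (THE v. is_interpolant b D u v)"

definition pl_utilities :: "real \<Rightarrow> real \<Rightarrow> observation list \<Rightarrow> (real \<Rightarrow> real) set" where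
  "pl_utilities b L D = interpolant b D ` utilities b L"

lemma finite_points: "valid_dataset b D \<Longrightarrow> finite (points b D)"
  by (auto simp: valid_dataset_def points_def)

lemma points_subset: "valid_dataset b D \<Longrightarrow> b > 0 \<Longrightarrow> points b D \<subseteq> {0..b}"
  by (auto simp: valid_dataset_def points_def)

lemma num_points_ge_2:
  assumes "valid_dataset b D" and "b > 0"
  shows "num_points b D \<ge> 2"
proof -
  have "card {0, b} \<le> card (points b D)"
    by (rule card_mono[OF finite_points[OF assms(1)]]) (auto simp: points_def)
  then show ?thesis using assms(2) by (simp add: num_points_def)
qed

lemma point_strict_mono:
  assumes "valid_dataset b D" and "1 \<le> i" and "i < j" and "j \<le> num_points b D"
  shows "point b D i < point b D j"
  unfolding point_def
  by (rule sorted_wrt_nth_less[OF strict_sorted_list_of_set])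
     (use assms in \<open>auto simp: num_points_def\<close>)

lemma point_mem:
  assumes "valid_dataset b D" and "1 \<le> j" and "j \<le> num_points b D"
  shows "point b D j \<in> points b D"
proof -
  have "point b D j \<in> set (sorted_list_of_set (points b D))"
    unfolding point_def by (rule nth_mem) (use assms in \<open>auto simp: num_points_def\<close>)
  then show ?thesis using finite_points[OF assms(1)] by simp
qed

lemma point_surj:
  assumes "valid_dataset b D" and "x \<in> points b D"
  obtains j where "1 \<le> j" and "j \<le> num_points b D" and "x = point b D j"
proof -
  have "x \<in> set (sorted_list_of_set (points b D))"
    using assms finite_points by simp
  then obtain i where "i < length (sorted_list_of_set (points b D))"
      "sorted_list_of_set (points b D) ! i = x"
    by (auto simp: in_set_conv_nth)
  then show thesis
    by (intro that[of "Suc i"]) (auto simp: point_def num_points_def)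
qed

lemma point_1:
  assumes "valid_dataset b D" and "b > 0"
  shows "point b D 1 = 0"
proof -
  have "0 \<in> points b D" by (simp add: points_def)
  then obtain j where j: "1 \<le> j" "j \<le> num_points b D" "0 = point b D j"
    using point_surj[OF assms(1)] by metis
  have ge: "point b D 1 \<ge> 0"
    using point_mem[OF assms(1), of 1] points_subset[OF assms] num_points_ge_2[OF assms] by auto
  have "\<not> 1 < j"
  proof
    assume "1 < j"
    from point_strict_mono[OF assms(1) order_refl this j(2)] ge j(3) show False by linarith
  qed
  then have "j = 1" using j(1) by linarith
  then show ?thesis using j(3) by simp
qed

lemma point_num_points:
  assumes "valid_dataset b D" and "b > 0"
  shows "point b D (num_points b D) = b"
proof -
  have "b \<in> points b D" by (simp add: points_def)
  then obtain j where j: "1 \<le> j" "j \<le> num_points b D" "b = point b D j"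
    using point_surj[OF assms(1)] by metis
  have le: "point b D (num_points b D) \<le> b"
    using point_mem[OF assms(1), of "num_points b D"] points_subset[OF assms]
      num_points_ge_2[OF assms] by auto
  have "\<not> j < num_points b D"
  proof
    assume "j < num_points b D"
    from point_strict_mono[OF assms(1) j(1) this order_refl] le j(3) show False by linarith
  qed
  then have "j = num_points b D" using j(2) by linarith
  then show ?thesis using j(3) by simp
qed

lemma segment_exists:
  assumes "valid_dataset b D" and "b > 0" and "x \<in> {0..b}"
  shows "\<exists>j\<in>{1..<num_points b D}. x \<in> {point b D j..point b D (j + 1)}"
proof -
  let ?N = "num_points b D"
  have "\<exists>j\<in>{1..<n}. x \<in> {point b D j..point b D (j + 1)}"
    if "2 \<le> n" "n \<le> ?N" "x \<le> point b D n" for n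
    using that
  proof (induction n rule: nat_induct_at_least)
    case base
    then show ?case using point_1[OF assms(1,2)] assms(3) by (intro bexI[of _ 1]) (auto simp: numeral_2_eq_2)
  next
    case (Suc n)
    show ?case
    proof (cases "x \<le> point b D n")
      case True
      then show ?thesis using Suc by fastforce
    next
      case False
      then show ?thesis using Suc by (intro bexI[of _ n]) auto
    qed
  qed
  from this[of ?N] show ?thesis
    using num_points_ge_2[OF assms(1,2)] point_num_points[OF assms(1,2)] assms(3) by auto
qed

lemma ex1_interpolant:
  assumes "valid_dataset b D" and "b > 0"
  shows "\<exists>!v. is_interpolant b D u v"
proof -
  let ?N = "num_points b D" and ?y = "point b D"
  let ?S = "\<lambda>j. {?y j..?y (j + 1)}"
  define g where "g j x = (u (?y (j + 1)) - u (?y j)) / (?y (j + 1) - ?y j) * (x - ?y j) + u (?y j)"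
    for j x
  have less: "?y j < ?y (j + 1)" if "j \<in> {1..<?N}" for j
    using that by (intro point_strict_mono[OF assms(1)]) auto
  have g_left: "g j (?y j) = u (?y j)" for j by (simp add: g_def)
  have g_right: "g j (?y (j + 1)) = u (?y (j + 1))" if "j \<in> {1..<?N}" for j
    using less[OF that] by (simp add: g_def)
  have g_agree_less: "g i x = g j x"
    if "i \<in> {1..<?N}" "j \<in> {1..<?N}" "x \<in> ?S i" "x \<in> ?S j" "i < j" for i j x
  proof -
    have "\<not> i + 1 < j"
      using that point_strict_mono[OF assms(1), of "i + 1" j] by auto
    then have "j = i + 1" using that by simp
    then show ?thesis using that g_left g_right by force
  qed
  have g_agree: "g i x = g j x"
    if "i \<in> {1..<?N}" "j \<in> {1..<?N}" "x \<in> ?S i" "x \<in> ?S j" for i j x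
    using g_agree_less[of i j x] g_agree_less[of j i x] that by (cases i j rule: linorder_cases) auto
  have S_subset: "?S j \<subseteq> {0..b}" if "j \<in> {1..<?N}" for j
    using that point_mem[OF assms(1), of j] point_mem[OF assms(1), of "j + 1"]
      points_subset[OF assms] by fastforce
  have cover: "{0..b} = (\<Union>j\<in>{1..<?N}. ?S j)"
    using S_subset segment_exists[OF assms] by blast
  define v where "v = (\<lambda>x\<in>{0..b}. g (SOME j. j \<in> {1..<?N} \<and> x \<in> ?S j) x)"
  have v_eq: "v x = g j x" if "j \<in> {1..<?N}" "x \<in> ?S j" for j x
  proof -
    have "(SOME j. j \<in> {1..<?N} \<and> x \<in> ?S j) \<in> {1..<?N} \<and> x \<in> ?S (SOME j. j \<in> {1..<?N} \<and> x \<in> ?S j)"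
      by (rule someI[of _ j]) (use that in blast)
    then have "g (SOME j. j \<in> {1..<?N} \<and> x \<in> ?S j) x = g j x"
      using g_agree that by blast
    moreover have "x \<in> {0..b}" using S_subset[OF that(1)] that(2) by blast
    ultimately show ?thesis by (simp add: v_def)
  qed
  have "is_interpolant b D u v"
    unfolding is_interpolant_def
  proof (intro conjI ballI)
    show "v \<in> extensional {0..b}" by (simp add: v_def)
    have "continuous_on (?S j) v" if "j \<in> {1..<?N}" for j
    proof -
      have "continuous_on (?S j) (g j)" unfolding g_def by (intro continuous_intros)
      then show ?thesis by (rule continuous_on_eq) (use v_eq[OF that] in metis)
    qed
    then show "continuous_on {0..b} v"
      unfolding cover by (intro continuous_on_closed_Union) auto
  next
    fix j assume j: "j \<in> {1..<?N}"
    let ?m = "(u (?y (j + 1)) - u (?y j)) / (?y (j + 1) - ?y j)"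
    have "\<forall>x\<in>?S j. v x = ?m * x + (u (?y j) - ?m * ?y j)"
    proof
      fix x assume "x \<in> ?S j"
      then have "v x = ?m * (x - ?y j) + u (?y j)" using v_eq[OF j] by (simp add: g_def)
      then show "v x = ?m * x + (u (?y j) - ?m * ?y j)" by (simp only: right_diff_distrib)
    qed
    then show "\<exists>m c. \<forall>x\<in>?S j. v x = m * x + c" by blast
  next
    fix j assume j: "j \<in> {1..?N}"
    show "v (?y j) = u (?y j)"
    proof (cases "j = ?N")
      case True
      then have "?N - 1 \<in> {1..<?N}" "j = (?N - 1) + 1" using num_points_ge_2[OF assms] by auto
      then show ?thesis using v_eq[of "?N - 1" "?y j"] g_right[of "?N - 1"] less[of "?N - 1"] by force
    next
      case False
      then have "j \<in> {1..<?N}" using j by auto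
      then show ?thesis using v_eq[of j "?y j"] g_left[of j] less[of j] by force
    qed
  qed
  moreover have "w = v" if w: "is_interpolant b D u w" for w
  proof (rule extensionalityI[of _ "{0..b}"])
    show "w \<in> extensional {0..b}" "v \<in> extensional {0..b}"
      using w by (simp_all add: is_interpolant_def v_def)
    fix x assume "x \<in> {0..b}"
    then obtain j where j: "j \<in> {1..<?N}" "x \<in> ?S j" using segment_exists[OF assms] by blast
    obtain m e where w_eq: "w t = m * t + e" if "t \<in> ?S j" for t
      using w j(1) unfolding is_interpolant_def by meson
    have "w (?y j) = u (?y j)" "w (?y (j + 1)) = u (?y (j + 1))"
      using w j(1) unfolding is_interpolant_def by auto
    then have ends: "u (?y j) = m * ?y j + e" "u (?y (j + 1)) = m * ?y (j + 1) + e"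
      using w_eq[of "?y j"] w_eq[of "?y (j + 1)"] less[OF j(1)] by auto
    have "u (?y (j + 1)) - u (?y j) = m * (?y (j + 1) - ?y j)"
      unfolding ends by (simp add: algebra_simps)
    then have "g j x = m * (x - ?y j) + u (?y j)"
      using less[OF j(1)] by (simp add: g_def)
    then show "w x = v x"
      using w_eq[OF j(2)] v_eq[OF j] ends(1) by (simp add: algebra_simps)
  qed
  ultimately show ?thesis by blast
qed

section \<open>The convex program and the estimator\<close>

text \<open>
  The vectors \<open>\<alpha>\<close> and \<open>\<beta>\<close> are functions of which only the components \<open>1, \<dots>, N\<close> and
  \<open>1, \<dots>, N - 1\<close>, respectively, are ever used.
\<close>

definition program_feasible ::
  "real \<Rightarrow> real \<Rightarrow> real \<Rightarrow> observation list \<Rightarrow> (nat \<Rightarrow> real) \<times> (nat \<Rightarrow> real) \<times> real \<Rightarrow> bool" where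
  "program_feasible b L c D = (\<lambda>(\<alpha>, \<beta>, \<gamma>).
     let N = num_points b D; y = point b D in
       \<gamma> \<in> {0..c} \<and>
       (\<forall>j\<in>{1..N-1}. \<beta> j = (\<alpha> (j + 1) - \<alpha> j) / (y (j + 1) - y j)) \<and>
       (\<forall>j\<in>{1..N-2}. \<beta> (j + 1) \<le> \<beta> j) \<and>
       \<beta> 1 \<le> L * \<gamma> \<and> \<beta> (N - 1) \<ge> 0 \<and> \<alpha> 1 = 0 \<and> \<alpha> N = \<gamma>)"

definition program_objective ::
  "real \<Rightarrow> observation list \<Rightarrow> (nat \<Rightarrow> real) \<times> (nat \<Rightarrow> real) \<times> real \<Rightarrow> real" where
  "program_objective b D = (\<lambda>(\<alpha>, \<beta>, \<gamma>).
     - (\<Sum>k=1..length D. ln (1 + exp (\<Sum>j=1..num_points b D.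
          - outcome (D ! (k - 1)) * prob_diff b D k j * \<alpha> j))))"

definition mle_utility ::
  "real \<Rightarrow> observation list \<Rightarrow> (nat \<Rightarrow> real) \<Rightarrow> (nat \<Rightarrow> real) \<Rightarrow> real \<Rightarrow> real \<Rightarrow> real" where
  "mle_utility b D \<alpha> \<beta> \<gamma> = (\<lambda>x\<in>{0..b}.
     if x = b then 1
     else let j = (THE j. j \<in> {1..<num_points b D} \<and> point b D j \<le> x \<and> x < point b D (j + 1))
          in \<beta> j / \<gamma> * (x - point b D j) + \<alpha> j / \<gamma>)"

end

theory Submission
  imports Defs
begin

text \<open>
  The substitution \<open>\<gamma> = 1 / \<sigma>\<close>, \<open>\<alpha>\<^sub>j = u (y\<^sub>j) / \<sigma>\<close> identifies the likelihood problem with the part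
  \<open>\<gamma> > 0\<close> of the convex program. The objective of the program is a sum of terms
  \<open>- ln (1 + exp t)\<close>, each strictly concave in \<open>t\<close>, so two optimal solutions give the same value of
  every \<open>t\<close>; full rank of the information matrix then forces them to coincide.
\<close>

section \<open>Piecewise linear functions with decreasing slopes\<close>

text \<open>A piecewise linear function with decreasing slopes is the lower envelope of its affine
  pieces. With \<open>z\<close> in segment \<open>i\<close>, the value at \<open>z\<close> of the
  extended piece \<open>k\<close> grows as \<open>k\<close> moves away from \<open>i\<close> in
  either direction.\<close>

lemma chord_le:
  fixes y a s :: "nat \<Rightarrow> real"
  assumes incr: "\<And>i j. 1 \<le> i \<Longrightarrow> i \<le> j \<Longrightarrow> j \<le> n \<Longrightarrow> y i \<le> y j"
    and step: "\<And>j. j \<in> {1..<n} \<Longrightarrow> a (j + 1) = a j + s j * (y (j + 1) - y j)"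
    and decr: "\<And>j. j + 1 \<in> {2..<n} \<Longrightarrow> s (j + 1) \<le> s j"
    and i: "i \<in> {1..<n}" and j: "j \<in> {1..<n}" and z: "z \<in> {y i..y (i + 1)}"
  shows "s i * (z - y i) + a i \<le> s j * (z - y j) + a j"
proof -
  let ?g = "\<lambda>j. s j * (z - y j) + a j"
  \<comment> \<open>Consecutive pieces agree at \<open>y (k + 1)\<close>, so their difference is
    linear in \<open>z\<close> and vanishes there; its sign is decided by the side of
    \<open>y (k + 1)\<close> on which \<open>z\<close> lies.\<close>
  have diff: "?g (k + 1) - ?g k = (s (k + 1) - s k) * (z - y (k + 1))" if "k + 1 \<in> {2..<n}" for k
    using step[of k] that by (simp add: algebra_simps)
  have nonpos: "s (k + 1) - s k \<le> 0" if "k + 1 \<in> {2..<n}" for k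
    using decr[OF that] by simp
  show ?thesis
  proof (cases "i \<le> j")
    case True
    then show ?thesis using j
    proof (induction j rule: dec_induct)
      case (step k)
      have k: "k + 1 \<in> {2..<n}" using step i by auto
      have "z - y (k + 1) \<le> 0" using incr[of "i + 1" "k + 1"] step i z by auto
      then have "?g k \<le> ?g (k + 1)"
        using diff[OF k] mult_nonpos_nonpos[OF nonpos[OF k]] by (metis diff_ge_0_iff_ge)
      then show ?case using step.IH step.prems step.hyps i by simp
    qed simp
  next
    case False
    then have "j \<le> i" by simp
    then show ?thesis using j
    proof (induction j rule: inc_induct)
      case (step k)
      have k: "k + 1 \<in> {2..<n}" using step i by auto
      have "0 \<le> z - y (k + 1)" using incr[of "k + 1" i] step i z by auto
      then have "?g (k + 1) \<le> ?g k"
        using diff[OF k] mult_nonpos_nonneg[OF nonpos[OF k]] by (metis diff_le_0_iff_le)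
      then show ?case using step.IH step.prems step.hyps i by simp
    qed simp
  qed
qed

text \<open>Comparing both end points with the supporting line at their convex combination
  \<open>w\<close> makes the linear terms cancel. The slope \<open>g x\<close> is any choice, so
  kinks cause no difficulty.\<close>

lemma concave_on_supergradient:
  fixes f g :: "real \<Rightarrow> real"
  assumes "convex S" and super: "\<And>x z. x \<in> S \<Longrightarrow> z \<in> S \<Longrightarrow> f z \<le> f x + g x * (z - x)"
  shows "concave_on S f"
  unfolding concave_on_iff
proof (intro conjI ballI allI impI)
  fix x z u v :: real
  assume *: "x \<in> S" "z \<in> S" "0 \<le> u" "0 \<le> v" "u + v = 1"
  define w where "w = u * x + v * z"
  have w: "w \<in> S" using convexD[OF assms(1) *(1,2)] * by (simp add: w_def)
  have "u * f x + v * f z \<le> u * (f w + g w * (x - w)) + v * (f w + g w * (z - w))"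
    using * super w by (intro add_mono mult_left_mono) auto
  also have "\<dots> = (u + v) * f w + g w * (u * x + v * z - (u + v) * w)"
    by (simp add: algebra_simps)
  also have "\<dots> = f w" using * by (simp add: w_def)
  finally show "u * f x + v * f z \<le> f (u *\<^sub>R x + v *\<^sub>R z)" by (simp add: w_def)
qed (fact assms(1))

section \<open>Feasible solutions and utilities\<close>

lemma segment_subset:
  assumes "valid_dataset b D" "b > 0" "j \<in> {1..<num_points b D}"
  shows "{point b D j..point b D (j + 1)} \<subseteq> {0..b}"
  using assms(3) point_mem[OF assms(1), of j] point_mem[OF assms(1), of "j + 1"]
    points_subset[OF assms(1,2)] by fastforce

lemma point_mono:
  assumes "valid_dataset b D" "1 \<le> i" "i \<le> j" "j \<le> num_points b D"
  shows "point b D i \<le> point b D j"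
  using point_strict_mono[OF assms(1,2) _ assms(4)] assms(3) by (cases "i = j") auto

lemma feasible_step:
  assumes "valid_dataset b D" "program_feasible b L c D (\<alpha>, \<beta>, \<gamma>)" "j \<in> {1..<num_points b D}"
  shows "\<alpha> (j + 1) = \<alpha> j + \<beta> j * (point b D (j + 1) - point b D j)"
proof -
  have "point b D j < point b D (j + 1)" using assms by (intro point_strict_mono) auto
  moreover have "\<beta> j = (\<alpha> (j + 1) - \<alpha> j) / (point b D (j + 1) - point b D j)"
    using assms(2,3) by (auto simp: program_feasible_def Let_def)
  ultimately show ?thesis by simp
qed

text \<open>The definition uses half-open pieces and a separate value at \<open>b\<close>. The
  affine formula extends to the closed segment because adjacent pieces match at the nodes and
  \<open>\<alpha>\<close> at the last node equals \<open>\<gamma>\<close>.\<close>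

lemma mle_utility_segment:
  assumes vd: "valid_dataset b D" and b: "b > 0"
    and feas: "program_feasible b L c D (\<alpha>, \<beta>, \<gamma>)" and \<gamma>: "\<gamma> > 0"
    and j: "j \<in> {1..<num_points b D}" and x: "x \<in> {point b D j..point b D (j + 1)}"
  shows "mle_utility b D \<alpha> \<beta> \<gamma> x = \<beta> j / \<gamma> * (x - point b D j) + \<alpha> j / \<gamma>"
proof -
  let ?N = "num_points b D" and ?y = "point b D"
  have xb: "x \<in> {0..b}" using segment_subset[OF vd b j] x by auto
  have bN: "?y ?N = b" using point_num_points[OF vd b] .
  have inner: "mle_utility b D \<alpha> \<beta> \<gamma> x = \<beta> i / \<gamma> * (x - ?y i) + \<alpha> i / \<gamma>"
    if i: "i \<in> {1..<?N}" and xi: "?y i \<le> x" "x < ?y (i + 1)" for i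
  proof -
    have "x < b" using xi point_mono[OF vd, of "i + 1" ?N] i bN by auto
    \<comment> \<open>Half-open segments are disjoint: a different index \<open>k\<close> would put
      \<open>x\<close> strictly beyond, or strictly before, its own segment.\<close>
    moreover have "(THE j. j \<in> {1..<?N} \<and> ?y j \<le> x \<and> x < ?y (j + 1)) = i"
    proof (rule the_equality)
      fix k assume k: "k \<in> {1..<?N} \<and> ?y k \<le> x \<and> x < ?y (k + 1)"
      show "k = i"
        using point_mono[OF vd, of "k + 1" i] point_mono[OF vd, of "i + 1" k] i k xi
        by (cases k i rule: linorder_cases) auto
    qed (use that in blast)
    ultimately show ?thesis using xb by (simp add: mle_utility_def)
  qed
  show ?thesis
  proof (cases "x < ?y (j + 1)")
    case True
    then show ?thesis using inner j x by auto
  next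
    case False
    then have xr: "x = ?y (j + 1)" using x by simp
    \<comment> \<open>At its right end the piece takes the value with which the next piece starts;
      on the last segment this is \<open>\<gamma> / \<gamma> = 1\<close>, the value prescribed at
      \<open>b\<close>.\<close>
    have right: "\<beta> j / \<gamma> * (x - ?y j) + \<alpha> j / \<gamma> = \<alpha> (j + 1) / \<gamma>"
      using feasible_step[OF vd feas j] xr by (simp add: add_divide_distrib)
    show ?thesis
    proof (cases "j + 1 = ?N")
      case True
      have "\<alpha> ?N = \<gamma>" using feas by (simp add: program_feasible_def Let_def)
      then show ?thesis using right \<gamma> True xr bN xb by (simp add: mle_utility_def)
    next
      case False
      then have "j + 1 \<in> {1..<?N}" using j by auto
      moreover have "x < ?y (j + 1 + 1)"
        unfolding xr using False j by (intro point_strict_mono[OF vd]) auto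
      ultimately show ?thesis using inner[of "j + 1"] xr right by simp
    qed
  qed
qed

lemma mle_utility_point:
  assumes vd: "valid_dataset b D" and b: "b > 0"
    and feas: "program_feasible b L c D (\<alpha>, \<beta>, \<gamma>)" and \<gamma>: "\<gamma> > 0"
    and j: "j \<in> {1..num_points b D}"
  shows "mle_utility b D \<alpha> \<beta> \<gamma> (point b D j) = \<alpha> j / \<gamma>"
proof (cases "j = num_points b D")
  case True
  then show ?thesis
    using point_num_points[OF vd b] b feas \<gamma>
    by (simp add: mle_utility_def program_feasible_def Let_def)
next
  case False
  then have "j \<in> {1..<num_points b D}" using j by auto
  from mle_utility_segment[OF vd b feas \<gamma> this, of "point b D j"] point_mono[OF vd, of j "j + 1"] this
  show ?thesis by auto
qed

text \<open>The program bounds only the first slope above and the last slope below; the decreasing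
  chain of slopes carries both bounds to every segment.\<close>

lemma feasible_slope_bounds:
  assumes feas: "program_feasible b L c D (\<alpha>, \<beta>, \<gamma>)" and j: "j \<in> {1..<num_points b D}"
  shows "0 \<le> \<beta> j" and "\<beta> j \<le> L * \<gamma>"
proof -
  let ?N = "num_points b D"
  have decr: "\<beta> (k + 1) \<le> \<beta> k" if "k \<in> {1..?N - 2}" for k
    using feas that by (simp add: program_feasible_def Let_def)
  have "j \<le> ?N - 1" using j by auto
  then have "\<beta> (?N - 1) \<le> \<beta> j"
  proof (induction j rule: inc_induct)
    case (step k)
    then have "k \<in> {1..?N - 2}" using j by auto
    then show ?case using decr[of k] step.IH by simp
  qed simp
  then show "0 \<le> \<beta> j" using feas by (simp add: program_feasible_def Let_def)
  have "1 \<le> j" using j by auto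
  then have "j < ?N \<Longrightarrow> \<beta> j \<le> \<beta> 1"
  proof (induction j rule: dec_induct)
    case (step k)
    then have "k \<in> {1..?N - 2}" by auto
    then show ?case using decr[of k] step by simp
  qed simp
  then show "\<beta> j \<le> L * \<gamma>" using feas j by (simp add: program_feasible_def Let_def)
qed

text \<open>The slope of a segment containing \<open>x\<close> serves as \<open>m\<close>, by the
  envelope property \<open>chord_le\<close>. This single inequality with \<open>m\<close> in
  \<open>{0..L}\<close> yields monotonicity, concavity and the Lipschitz bound together.\<close>

lemma mle_utility_supergradient:
  assumes vd: "valid_dataset b D" and b: "b > 0"
    and feas: "program_feasible b L c D (\<alpha>, \<beta>, \<gamma>)" and \<gamma>: "\<gamma> > 0"
    and x: "x \<in> {0..b}"
  shows "\<exists>m\<in>{0..L}. \<forall>z\<in>{0..b}.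
    mle_utility b D \<alpha> \<beta> \<gamma> z \<le> mle_utility b D \<alpha> \<beta> \<gamma> x + m * (z - x)"
proof -
  let ?N = "num_points b D" and ?y = "point b D" and ?u = "mle_utility b D \<alpha> \<beta> \<gamma>"
  obtain j where j: "j \<in> {1..<?N}" "x \<in> {?y j..?y (j + 1)}"
    using segment_exists[OF vd b x] by blast
  note ux = mle_utility_segment[OF vd b feas \<gamma> j]
  have "\<beta> j / \<gamma> \<in> {0..L}"
    using feasible_slope_bounds[OF feas j(1)] \<gamma> by (simp add: divide_simps)
  moreover have "?u z \<le> ?u x + \<beta> j / \<gamma> * (z - x)" if z: "z \<in> {0..b}" for z
  proof -
    obtain i where i: "i \<in> {1..<?N}" "z \<in> {?y i..?y (i + 1)}"
      using segment_exists[OF vd b z] by blast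
    have "\<beta> i * (z - ?y i) + \<alpha> i \<le> \<beta> j * (z - ?y j) + \<alpha> j"
    proof (rule chord_le[of ?N])
      show "\<beta> (k + 1) \<le> \<beta> k" if "k + 1 \<in> {2..<?N}" for k
        using feas that by (auto simp: program_feasible_def Let_def)
    qed (use i j point_mono[OF vd] feasible_step[OF vd feas] in auto)
    from divide_right_mono[OF this, of \<gamma>] \<gamma>
    have "?u z \<le> \<beta> j / \<gamma> * (z - ?y j) + \<alpha> j / \<gamma>"
      using mle_utility_segment[OF vd b feas \<gamma> i] by (simp add: add_divide_distrib)
    moreover have "\<beta> j / \<gamma> * (z - ?y j) = \<beta> j / \<gamma> * (x - ?y j) + \<beta> j / \<gamma> * (z - x)"
      by (simp only: distrib_left[symmetric]) simp
    ultimately show ?thesis unfolding ux by linarith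
  qed
  ultimately show ?thesis by blast
qed

lemma mle_utility_in_utilities:
  assumes vd: "valid_dataset b D" and b: "b > 0" and L: "L > 0"
    and feas: "program_feasible b L c D (\<alpha>, \<beta>, \<gamma>)" and \<gamma>: "\<gamma> > 0"
  shows "mle_utility b D \<alpha> \<beta> \<gamma> \<in> utilities b L"
proof -
  let ?u = "mle_utility b D \<alpha> \<beta> \<gamma>"
  obtain g where g: "g x \<in> {0..L}" "?u z \<le> ?u x + g x * (z - x)"
    if "x \<in> {0..b}" "z \<in> {0..b}" for x z
    using mle_utility_supergradient[OF vd b feas \<gamma>] by metis
  have mono: "?u x \<le> ?u z" if "x \<in> {0..b}" "z \<in> {0..b}" "x \<le> z" for x z
  proof -
    \<comment> \<open>Monotonicity takes the supporting line at the right point, where a nonnegative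
      slope helps; the Lipschitz bound below takes it at the left point, where the slope is at most
      \<open>L\<close>.\<close>
    have "g z * (x - z) \<le> 0"
      using g(1)[OF that(2,1)] that(3) by (intro mult_nonneg_nonpos) auto
    then show ?thesis using g(2)[OF that(2,1)] by linarith
  qed
  have lip: "?u z - ?u x \<le> L * (z - x)" if "x \<in> {0..b}" "z \<in> {0..b}" "x \<le> z" for x z
  proof -
    have "g x * (z - x) \<le> L * (z - x)"
      using g(1)[OF that(1,2)] that(3) by (intro mult_right_mono) auto
    then show ?thesis using g(2)[OF that(1,2)] by linarith
  qed
  have "L-lipschitz_on {0..b} ?u"
  proof (rule lipschitz_onI)
    fix x z assume xz: "x \<in> {0..b}" "z \<in> {0..b}"
    show "dist (?u x) (?u z) \<le> L * dist x z"
      using mono[OF xz] mono[OF xz(2,1)] lip[OF xz] lip[OF xz(2,1)]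
      by (cases "x \<le> z") (auto simp: dist_real_def abs_if)
  qed (use L in simp)
  moreover have "?u 0 = 0"
    using mle_utility_point[OF vd b feas \<gamma>, of 1] num_points_ge_2[OF vd b] point_1[OF vd b] feas
    by (simp add: program_feasible_def Let_def)
  moreover have "concave_on {0..b} ?u"
    by (rule concave_on_supergradient[where g = g]) (use g in auto)
  moreover have "mono_on {0..b} ?u" by (rule mono_onI) (use mono in auto)
  moreover have "?u \<in> extensional {0..b}" "?u b = 1" using b by (simp_all add: mle_utility_def)
  ultimately show ?thesis by (simp add: utilities_def)
qed

text \<open>The function \<open>u\<close> is left general: taking the estimator itself shows that it
  is its own interpolant, and taking another optimal utility later gives uniqueness.\<close>

lemma mle_utility_is_interpolant:
  assumes vd: "valid_dataset b D" and b: "b > 0" and L: "L > 0"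
    and feas: "program_feasible b L c D (\<alpha>, \<beta>, \<gamma>)" and \<gamma>: "\<gamma> > 0"
    and u: "\<And>j. j \<in> {1..num_points b D} \<Longrightarrow> u (point b D j) = \<alpha> j / \<gamma>"
  shows "is_interpolant b D u (mle_utility b D \<alpha> \<beta> \<gamma>)"
  unfolding is_interpolant_def
proof (intro conjI ballI)
  let ?v = "mle_utility b D \<alpha> \<beta> \<gamma>"
  have "?v \<in> utilities b L" using mle_utility_in_utilities[OF vd b L feas \<gamma>] .
  then show "?v \<in> extensional {0..b}" "continuous_on {0..b} ?v"
    by (auto simp: utilities_def intro: lipschitz_on_continuous_on)
  fix j assume j: "j \<in> {1..<num_points b D}"
  have "\<forall>x\<in>{point b D j..point b D (j + 1)}.
      ?v x = \<beta> j / \<gamma> * x + (\<alpha> j / \<gamma> - \<beta> j / \<gamma> * point b D j)"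
    using mle_utility_segment[OF vd b feas \<gamma> j] by (simp add: algebra_simps)
  then show "\<exists>m c. \<forall>x\<in>{point b D j..point b D (j + 1)}. ?v x = m * x + c" by blast
qed (use u mle_utility_point[OF vd b feas \<gamma>] in simp)

lemma interpolant_eqI:
  assumes "valid_dataset b D" "b > 0" "is_interpolant b D u v"
  shows "interpolant b D u = v"
  unfolding interpolant_def
  by (rule the1_equality[OF ex1_interpolant[OF assms(1,2)]]) (fact assms(3))

lemma interpolant_point:
  assumes "valid_dataset b D" "b > 0" "j \<in> {1..num_points b D}"
  shows "interpolant b D u (point b D j) = u (point b D j)"
proof -
  have "is_interpolant b D u (interpolant b D u)"
    unfolding interpolant_def using ex1_interpolant[OF assms(1,2)] by (rule theI')
  then show ?thesis using assms(3) by (simp add: is_interpolant_def)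
qed

lemma mle_utility_in_pl_utilities:
  assumes "valid_dataset b D" "b > 0" "L > 0" "program_feasible b L c D (\<alpha>, \<beta>, \<gamma>)" "\<gamma> > 0"
  shows "mle_utility b D \<alpha> \<beta> \<gamma> \<in> pl_utilities b L D"
proof -
  let ?u = "mle_utility b D \<alpha> \<beta> \<gamma>"
  have "is_interpolant b D ?u ?u"
    by (rule mle_utility_is_interpolant[OF assms mle_utility_point[OF assms(1,2,4,5)]])
  from interpolant_eqI[OF assms(1,2) this] mle_utility_in_utilities[OF assms]
  show ?thesis unfolding pl_utilities_def by (metis imageI)
qed

text \<open>Only node values are compared, so this applies both to the estimator and to the
  interpolant of an arbitrary utility.\<close>

lemma log_likelihood_eq_objective:
  assumes "\<And>j. j \<in> {1..num_points b D} \<Longrightarrow> \<alpha> j = u (point b D j) / \<sigma>"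
  shows "log_likelihood b D u \<sigma> = program_objective b D (\<alpha>, \<beta>, \<gamma>)"
proof -
  have "(\<Sum>j=1..num_points b D. - outcome (D ! (k - 1)) * prob_diff b D k j * u (point b D j)) / \<sigma>
      = (\<Sum>j=1..num_points b D. - outcome (D ! (k - 1)) * prob_diff b D k j * \<alpha> j)" for k
    unfolding sum_divide_distrib using assms by (intro sum.cong) auto
  then show ?thesis by (simp add: log_likelihood_def program_objective_def)
qed

section \<open>From utilities to feasible solutions\<close>

lemma concave_slope_decreasing:
  fixes u :: "real \<Rightarrow> real"
  assumes "concave_on S u" "x \<in> S" "z \<in> S" "x < y" "y < z"
  shows "(u z - u y) / (z - y) \<le> (u y - u x) / (y - x)"
proof -
  \<comment> \<open>The weight for which \<open>y = t * x + (1 - t) * z\<close>; multiplying the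
    concavity inequality by \<open>z - x\<close> then clears the denominators.\<close>
  define t where "t = (z - y) / (z - x)"
  have t: "0 \<le> t" "0 \<le> 1 - t" "t + (1 - t) = 1" using assms by (auto simp: t_def divide_simps)
  have "t * (z - x) = z - y" using assms by (simp add: t_def)
  then have y: "t * x + (1 - t) * z = y" by (simp add: algebra_simps)
  have "t * u x + (1 - t) * u z \<le> u (t *\<^sub>R x + (1 - t) *\<^sub>R z)"
    using assms(1-3) t unfolding concave_on_iff by blast
  then have "t * u x + (1 - t) * u z \<le> u y" by (simp add: y)
  then have "(z - x) * (t * u x + (1 - t) * u z) \<le> (z - x) * u y"
    using assms by (intro mult_left_mono) auto
  moreover have "(z - x) * t = z - y" "(z - x) * (1 - t) = y - x"
    using assms by (auto simp: t_def field_simps)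
  ultimately have "(z - y) * u x + (y - x) * u z \<le> (z - x) * u y"
    by (metis (no_types, lifting) distrib_left mult.assoc)
  then show ?thesis using assms by (simp add: field_simps)
qed

text \<open>Each constraint comes from one property of \<open>u\<close>: decreasing slopes from
  concavity, the bound on the first slope from the Lipschitz modulus, the sign of the last slope
  from monotonicity, and the end values from \<open>u 0 = 0\<close> and \<open>u b = 1\<close>. The
  cap \<open>c\<close> on \<open>1 / \<tau>\<close> is the lower bound on the scale.\<close>

lemma feasible_of_utility:
  assumes vd: "valid_dataset b D" and b: "b > 0" and c: "c > 0" and \<tau>: "\<tau> \<ge> 1 / c"
    and u: "u \<in> utilities b L"
  shows "program_feasible b L c D (\<lambda>j. u (point b D j) / \<tau>,
    \<lambda>j. (u (point b D (j + 1)) / \<tau> - u (point b D j) / \<tau>) / (point b D (j + 1) - point b D j), 1 / \<tau>)"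
proof -
  let ?N = "num_points b D" and ?y = "point b D"
  \<comment> \<open>The slopes before scaling; the constraints are proved for these and divided by
    the positive \<open>\<tau>\<close> at the end.\<close>
  define s where "s j = (u (?y (j + 1)) - u (?y j)) / (?y (j + 1) - ?y j)" for j
  have \<tau>0: "\<tau> > 0" using \<tau> c by (smt (verit) divide_pos_pos)
  have slope: "(u (?y (j + 1)) / \<tau> - u (?y j) / \<tau>) / (?y (j + 1) - ?y j) = s j / \<tau>" for j
    by (simp add: s_def diff_divide_distrib[symmetric] mult.commute)
  have N: "?N \<ge> 2" using num_points_ge_2[OF vd b] .
  have mem: "?y j \<in> {0..b}" if "1 \<le> j" "j \<le> ?N" for j
    using point_mem[OF vd that] points_subset[OF vd b] by blast
  have less: "?y j < ?y (j + 1)" if "1 \<le> j" "j < ?N" for j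
    using that by (intro point_strict_mono[OF vd]) auto
  have "s (j + 1) \<le> s j" if "j \<in> {1..?N - 2}" for j
    unfolding s_def
  proof (rule concave_slope_decreasing)
    show "concave_on {0..b} u" using u by (simp add: utilities_def)
  qed (use that N mem less[of j] less[of "j + 1"] in auto)
  moreover have "s 1 \<le> L"
  proof -
    have "dist (u (?y (1 + 1))) (u (?y 1)) \<le> L * dist (?y (1 + 1)) (?y 1)"
      using u N mem by (intro lipschitz_onD[of _ "{0..b}"]) (auto simp: utilities_def)
    then show ?thesis using less[of 1] N by (simp add: s_def dist_real_def divide_simps mult.commute)
  qed
  moreover have "s (?N - 1) \<ge> 0"
  proof -
    have "u (?y (?N - 1)) \<le> u (?y (?N - 1 + 1))"
      using u N mem point_mono[OF vd, of "?N - 1" ?N]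
      by (intro mono_onD[of "{0..b}" u]) (auto simp: utilities_def)
    moreover have "?y (?N - 1) \<le> ?y (?N - 1 + 1)" using N by (intro point_mono[OF vd]) auto
    ultimately show ?thesis by (simp add: s_def)
  qed
  ultimately have "\<forall>j\<in>{1..?N - 2}. s (j + 1) / \<tau> \<le> s j / \<tau>" "s 1 / \<tau> \<le> L / \<tau>"
    "s (?N - 1) / \<tau> \<ge> 0"
    using \<tau>0 by (auto intro: divide_right_mono)
  moreover have "1 / \<tau> \<in> {0..c}" using \<tau>0 \<tau> c by (simp add: field_simps)
  moreover have "u (?y 1) / \<tau> = 0" "u (?y ?N) / \<tau> = 1 / \<tau>"
    using u point_1[OF vd b] point_num_points[OF vd b] by (simp_all add: utilities_def)
  ultimately show ?thesis
    unfolding program_feasible_def prod.case Let_def slope by auto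
qed

section \<open>Strict concavity of the program\<close>

text \<open>With \<open>p = exp (s / 2)\<close> and \<open>q = exp (t / 2)\<close> this is the
  strict Cauchy-Schwarz inequality for \<open>(1, p)\<close> and \<open>(1, q)\<close>, whose defect
  is \<open>(p - q)\<^sup>2\<close>; taking logarithms finishes.\<close>

lemma softplus_midpoint_less:
  fixes s t :: real
  assumes "s \<noteq> t"
  shows "ln (1 + exp ((s + t) / 2)) < (ln (1 + exp s) + ln (1 + exp t)) / 2"
proof -
  define p q where "p = exp (s / 2)" and "q = exp (t / 2)"
  have pq: "exp s = p\<^sup>2" "exp t = q\<^sup>2" "exp ((s + t) / 2) = p * q"
    by (simp_all add: p_def q_def power2_eq_square add_divide_distrib flip: exp_add)
  have "0 < p * q" by (simp add: p_def q_def)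
  then have pos: "0 < 1 + p * q" "0 < 1 + p\<^sup>2" "0 < 1 + q\<^sup>2" by (simp_all add: add_pos_nonneg)
  have "0 < (p - q)\<^sup>2" using assms by (simp add: p_def q_def)
  then have "(1 + p * q)\<^sup>2 < (1 + p\<^sup>2) * (1 + q\<^sup>2)"
    by (simp add: power2_eq_square algebra_simps)
  then have "ln ((1 + p * q)\<^sup>2) < ln ((1 + p\<^sup>2) * (1 + q\<^sup>2))"
    using pos by (subst ln_less_cancel_iff) auto
  then have "2 * ln (1 + p * q) < ln (1 + p\<^sup>2) + ln (1 + q\<^sup>2)"
    using pos by (simp add: ln_realpow ln_mult_pos)
  then show ?thesis by (simp add: pq)
qed

text \<open>All constraints are linear in the three unknowns because the nodes are fixed. Midpoint
  convexity is all that the comparison of two optimal solutions uses.\<close>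

lemma feasible_midpoint:
  assumes "program_feasible b L c D (\<alpha>, \<beta>, \<gamma>)" "program_feasible b L c D (\<alpha>', \<beta>', \<gamma>')"
  shows "program_feasible b L c D
    (\<lambda>j. (\<alpha> j + \<alpha>' j) / 2, \<lambda>j. (\<beta> j + \<beta>' j) / 2, (\<gamma> + \<gamma>') / 2)"
proof -
  note f = assms[unfolded program_feasible_def prod.case Let_def]
  have slope: "((p + q) / 2 - (r + s) / 2) / d = ((p - r) / d + (q - s) / d) / 2"
    for p q r s d :: real
    by (simp add: diff_divide_distrib add_divide_distrib)
  have decr: "(\<beta> (j + 1) + \<beta>' (j + 1)) / 2 \<le> (\<beta> j + \<beta>' j) / 2" if "j \<in> {1..num_points b D - 2}" for j
    using f that by (intro divide_right_mono add_mono) auto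
  have "(\<beta> 1 + \<beta>' 1) / 2 \<le> L * ((\<gamma> + \<gamma>') / 2)"
  proof -
    have "\<beta> 1 + \<beta>' 1 \<le> L * \<gamma> + L * \<gamma>'" using f by (intro add_mono) auto
    then show ?thesis by (simp add: algebra_simps)
  qed
  with f decr show ?thesis
    unfolding program_feasible_def prod.case Let_def slope by auto
qed

text \<open>If the exponents of two optimal solutions differed for some observation, strict
  concavity in that exponent would make the feasible midpoint beat the common optimal value. This
  alone does not yet identify the vectors \<open>\<alpha>\<close>.\<close>

lemma optimal_margins_eq:
  assumes opt: "is_arg_max (program_objective b D) (program_feasible b L c D) (\<alpha>, \<beta>, \<gamma>)"
    and opt': "is_arg_max (program_objective b D) (program_feasible b L c D) (\<alpha>', \<beta>', \<gamma>')"
    and k: "k \<in> {1..length D}"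
  shows "(\<Sum>j=1..num_points b D. - outcome (D ! (k - 1)) * prob_diff b D k j * \<alpha> j)
    = (\<Sum>j=1..num_points b D. - outcome (D ! (k - 1)) * prob_diff b D k j * \<alpha>' j)"
proof (rule ccontr)
  define m where "m a k = (\<Sum>j=1..num_points b D.
    - outcome (D ! (k - 1)) * prob_diff b D k j * a j)" for a k
  let ?h = "\<lambda>t :: real. ln (1 + exp t)"
  let ?mid = "\<lambda>j. (\<alpha> j + \<alpha>' j) / 2"
  have m_mid: "m ?mid i = (m \<alpha> i + m \<alpha>' i) / 2" for i
    by (simp add: m_def sum.distrib[symmetric] sum_divide_distrib distrib_left)
  have obj: "program_objective b D (a, s, g) = - (\<Sum>i=1..length D. ?h (m a i))" for a s g
    by (simp add: program_objective_def m_def)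
  assume "\<not> ?thesis"
  then have ne: "m \<alpha> k \<noteq> m \<alpha>' k" by (simp add: m_def)
  \<comment> \<open>Where the two exponents agree the inequality is an equality, elsewhere it is
    strict; one strict term, at \<open>k\<close>, suffices for the sum.\<close>
  have le: "?h (m ?mid i) \<le> (?h (m \<alpha> i) + ?h (m \<alpha>' i)) / 2" for i
    unfolding m_mid using softplus_midpoint_less[of "m \<alpha> i" "m \<alpha>' i"]
    by (cases "m \<alpha> i = m \<alpha>' i") auto
  have "(\<Sum>i=1..length D. ?h (m ?mid i)) < (\<Sum>i=1..length D. (?h (m \<alpha> i) + ?h (m \<alpha>' i)) / 2)"
  proof (rule sum_strict_mono_ex1)
    show "\<exists>i\<in>{1..length D}. ?h (m ?mid i) < (?h (m \<alpha> i) + ?h (m \<alpha>' i)) / 2"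
      unfolding m_mid using softplus_midpoint_less[OF ne] k by blast
  qed (use le in auto)
  also have "\<dots> = ((\<Sum>i=1..length D. ?h (m \<alpha> i)) + (\<Sum>i=1..length D. ?h (m \<alpha>' i))) / 2"
    by (simp add: sum.distrib flip: sum_divide_distrib)
  finally have "program_objective b D (\<alpha>, \<beta>, \<gamma>) + program_objective b D (\<alpha>', \<beta>', \<gamma>')
      < 2 * program_objective b D (?mid, \<lambda>j. (\<beta> j + \<beta>' j) / 2, (\<gamma> + \<gamma>') / 2)"
    unfolding obj by simp
  moreover have "program_feasible b L c D (?mid, \<lambda>j. (\<beta> j + \<beta>' j) / 2, (\<gamma> + \<gamma>') / 2)"
    using opt opt' by (intro feasible_midpoint) (auto simp: is_arg_max_def)
  \<comment> \<open>Neither optimal value lies below the value at the midpoint, so their sum cannot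
    be less than twice it.\<close>
  ultimately show False
    using opt opt' unfolding is_arg_max_def by (smt (verit))
qed

section \<open>Full rank and uniqueness of the optimal solution\<close>

lemma smult_mat_mult_vec:
  fixes A :: "'a :: comm_semiring_0 mat"
  assumes "A \<in> carrier_mat m n" "x \<in> carrier_vec n"
  shows "(k \<cdot>\<^sub>m A) *\<^sub>v x = k \<cdot>\<^sub>v (A *\<^sub>v x)"
  using assms by (intro eq_vecI) (auto simp: scalar_prod_def sum_distrib_left mult.assoc)

text \<open>The kernel of the design matrix lies in the kernel of the information matrix, which is
  trivial because a square matrix of full rank has nonzero determinant.\<close>

lemma design_matrix_injective:
  assumes rank: "vec_space.rank (num_points b D - 1) (information_matrix b D) = num_points b D - 1"
    and x: "x \<in> carrier_vec (num_points b D - 1)"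
    and zero: "design_matrix b D *\<^sub>v x = 0\<^sub>v (length D)"
  shows "x = 0\<^sub>v (num_points b D - 1)"
proof -
  let ?n = "num_points b D - 1" and ?P = "design_matrix b D" and ?S = "information_matrix b D"
  have P: "?P \<in> carrier_mat (length D) ?n" by (simp add: design_matrix_def)
  then have S: "?S \<in> carrier_mat ?n ?n" by (simp add: information_matrix_def)
  have "det ?S \<noteq> 0" using vec_space.det_rank_iff[OF S] rank by blast
  moreover have "?S *\<^sub>v x = 0\<^sub>v ?n"
  proof -
    have "transpose_mat ?P * ?P *\<^sub>v x = transpose_mat ?P *\<^sub>v (?P *\<^sub>v x)"
      using P x by (intro assoc_mult_mat_vec[of _ ?n "length D"]) auto
    also have "\<dots> = 0\<^sub>v ?n" unfolding zero using P by (intro eq_vecI) auto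
    finally have "transpose_mat ?P * ?P *\<^sub>v x = 0\<^sub>v ?n" .
    then have "?S *\<^sub>v x = (1 / real (length D)) \<cdot>\<^sub>v 0\<^sub>v ?n"
      using P smult_mat_mult_vec[of "transpose_mat ?P * ?P" ?n ?n x] x
      by (simp add: information_matrix_def)
    also have "\<dots> = 0\<^sub>v ?n" by (intro eq_vecI) auto
    finally show ?thesis .
  qed
  ultimately show ?thesis using det_0_iff_vec_prod_zero_field[OF S] x by blast
qed

text \<open>The difference of two optimal vectors vanishes at the first node, and equal exponents
  put its remaining entries in the kernel of the design matrix. The other unknowns are functions of
  \<open>\<alpha>\<close> by the constraints.\<close>

lemma optimal_solution_unique:
  assumes vd: "valid_dataset b D" and b: "b > 0"
    and rank: "vec_space.rank (num_points b D - 1) (information_matrix b D) = num_points b D - 1"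
    and opt: "is_arg_max (program_objective b D) (program_feasible b L c D) (\<alpha>, \<beta>, \<gamma>)"
    and opt': "is_arg_max (program_objective b D) (program_feasible b L c D) (\<alpha>', \<beta>', \<gamma>')"
    and j: "j \<in> {1..num_points b D}"
  shows "\<alpha> j = \<alpha>' j"
proof -
  let ?N = "num_points b D"
  define d where "d j = \<alpha> j - \<alpha>' j" for j
  have N: "?N \<ge> 2" using num_points_ge_2[OF vd b] .
  have d1: "d 1 = 0"
    using opt opt' by (simp add: d_def is_arg_max_def program_feasible_def Let_def)
  have ortho: "(\<Sum>i<?N - 1. prob_diff b D (k + 1) (i + 2) * d (i + 2)) = 0" if k: "k < length D" for k
  proof -
    have "outcome (D ! k) \<in> {1, -1}" using vd k by (auto simp: valid_dataset_def)
    \<comment> \<open>The outcome is \<open>1\<close> or \<open>-1\<close>, so this factor can be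
      cancelled.\<close>
    moreover have "outcome (D ! k) * (\<Sum>j=1..?N. prob_diff b D (k + 1) j * d j) = 0"
      using optimal_margins_eq[OF opt opt', of "k + 1"] k
      by (simp add: d_def sum_distrib_left right_diff_distrib sum_subtractf sum_negf mult.assoc)
    ultimately have "(\<Sum>j=1..?N. prob_diff b D (k + 1) j * d j) = 0" by auto
    \<comment> \<open>The design matrix has no column for the first node; dropping that term is
      harmless since \<open>d 1 = 0\<close>.\<close>
    moreover have "{1..?N} = insert 1 {2..?N}" using N by auto
    ultimately have "(\<Sum>j=2..?N. prob_diff b D (k + 1) j * d j) = 0" using d1 by simp
    moreover have "(\<Sum>i<?N - 1. prob_diff b D (k + 1) (i + 2) * d (i + 2))
        = (\<Sum>j=2..?N. prob_diff b D (k + 1) j * d j)"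
      \<comment> \<open>Column \<open>i\<close>, counted from \<open>0\<close>, belongs to node
        \<open>i + 2\<close>.\<close>
      by (rule sum.reindex_bij_witness[of _ "\<lambda>j. j - 2" "\<lambda>i. i + 2"]) (use N in auto)
    ultimately show ?thesis by simp
  qed
  define x where "x = vec (?N - 1) (\<lambda>i. d (i + 2))"
  have "design_matrix b D *\<^sub>v x = 0\<^sub>v (length D)"
    using ortho by (intro eq_vecI) (auto simp: design_matrix_def x_def scalar_prod_def atLeast0LessThan)
  then have "x = 0\<^sub>v (?N - 1)"
    using design_matrix_injective[OF rank] by (simp add: x_def)
  then have "d (i + 2) = 0" if "i < ?N - 1" for i
    using that by (metis index_vec index_zero_vec(1) x_def)
  from this[of "j - 2"] have "d j = 0"
    using d1 j by (cases "j = 1") (auto simp: numeral_2_eq_2 Suc_diff_Suc)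
  then show ?thesis by (simp add: d_def)
qed

section \<open>Transfer of uniqueness to the likelihood problem\<close>

theorem proposition3:
  fixes b L c :: real and D :: "observation list"
    and \<alpha> \<beta> :: "nat \<Rightarrow> real" and \<gamma> :: real
  assumes "b > 0" and "L > 0" and "c > 0"
    and "valid_dataset b D"
    and "vec_space.rank (num_points b D - 1) (information_matrix b D) = num_points b D - 1"
    and "is_arg_max (program_objective b D) (program_feasible b L c D) (\<alpha>, \<beta>, \<gamma>)"
    and "\<gamma> > 0"
  shows "{(u, \<sigma>). is_arg_max (\<lambda>(v, \<tau>). log_likelihood b D v \<tau>)
             (\<lambda>(v, \<tau>). v \<in> pl_utilities b L D \<and> \<tau> \<ge> 1 / c) (u, \<sigma>)}
         = {(mle_utility b D \<alpha> \<beta> \<gamma>, 1 / \<gamma>)}"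
proof -
  note b = assms(1) and L = assms(2) and c = assms(3) and vd = assms(4) and rank = assms(5)
    and opt = assms(6) and \<gamma> = assms(7)
  let ?N = "num_points b D" and ?y = "point b D" and ?m = "mle_utility b D \<alpha> \<beta> \<gamma>"
  let ?obj = "program_objective b D"
  have feas: "program_feasible b L c D (\<alpha>, \<beta>, \<gamma>)"
    and max: "\<And>p. program_feasible b L c D p \<Longrightarrow> ?obj p \<le> ?obj (\<alpha>, \<beta>, \<gamma>)"
    using opt by (auto simp: is_arg_max_def not_less)
  have m_pl: "?m \<in> pl_utilities b L D"
    using mle_utility_in_pl_utilities[OF vd b L feas \<gamma>] .
  have "\<gamma> \<le> c" using feas by (simp add: program_feasible_def Let_def)
  then have m_scale: "1 / \<gamma> \<ge> 1 / c" using \<gamma> c by (simp add: frac_le)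
  have m_value: "log_likelihood b D ?m (1 / \<gamma>) = ?obj (\<alpha>, \<beta>, \<gamma>)"
    by (rule log_likelihood_eq_objective) (use mle_utility_point[OF vd b feas \<gamma>] \<gamma> in simp)
  \<comment> \<open>The upper bound and its equality case are proved together: the first, with
    \<open>m_value\<close>, makes the estimator optimal, the second excludes any other
    maximizer.\<close>
  have bound: "log_likelihood b D v \<tau> \<le> ?obj (\<alpha>, \<beta>, \<gamma>) \<and>
      (log_likelihood b D v \<tau> = ?obj (\<alpha>, \<beta>, \<gamma>) \<longrightarrow> v = ?m \<and> \<tau> = 1 / \<gamma>)"
    if v: "v \<in> pl_utilities b L D" and \<tau>: "\<tau> \<ge> 1 / c" for v \<tau>
  proof -
    obtain u where u: "u \<in> utilities b L" and v_eq: "v = interpolant b D u"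
      using v by (auto simp: pl_utilities_def)
    \<comment> \<open>The feasible point is built from the utility \<open>u\<close> behind
      \<open>v\<close>; both have the same node values, hence the same likelihood.\<close>
    define \<alpha>' where "\<alpha>' = (\<lambda>j. u (?y j) / \<tau>)"
    define \<beta>' where "\<beta>' = (\<lambda>j. (\<alpha>' (j + 1) - \<alpha>' j) / (?y (j + 1) - ?y j))"
    have feas': "program_feasible b L c D (\<alpha>', \<beta>', 1 / \<tau>)"
      unfolding \<alpha>'_def \<beta>'_def using feasible_of_utility[OF vd b c \<tau> u] .
    have value': "log_likelihood b D v \<tau> = ?obj (\<alpha>', \<beta>', 1 / \<tau>)"
      by (rule log_likelihood_eq_objective)
        (use interpolant_point[OF vd b] v_eq in \<open>simp add: \<alpha>'_def\<close>)
    moreover have "v = ?m \<and> \<tau> = 1 / \<gamma>" if "?obj (\<alpha>', \<beta>', 1 / \<tau>) = ?obj (\<alpha>, \<beta>, \<gamma>)"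
    proof -
      have opt': "is_arg_max ?obj (program_feasible b L c D) (\<alpha>', \<beta>', 1 / \<tau>)"
        using feas' max that by (auto simp: is_arg_max_def not_less)
      have eq: "\<alpha> j = \<alpha>' j" if "j \<in> {1..?N}" for j
        using optimal_solution_unique[OF vd b rank opt opt' that] .
      \<comment> \<open>The last entry of a feasible \<open>\<alpha>\<close> is its
        \<open>\<gamma>\<close>, so equal vectors force equal scales.\<close>
      have "\<gamma> = 1 / \<tau>"
        using eq[of ?N] num_points_ge_2[OF vd b] feas feas'
        by (simp add: program_feasible_def Let_def)
      then have \<tau>_eq: "\<tau> = 1 / \<gamma>" by simp
      \<comment> \<open>Now \<open>u\<close> takes the node values of the estimator, so
        \<open>v\<close> and the estimator are both the interpolant of \<open>u\<close>.\<close>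
      have "is_interpolant b D u ?m"
        by (rule mle_utility_is_interpolant[OF vd b L feas \<gamma>])
          (use eq \<gamma> \<tau>_eq in \<open>simp add: \<alpha>'_def\<close>)
      then show ?thesis using interpolant_eqI[OF vd b] v_eq \<tau>_eq by simp
    qed
    ultimately show ?thesis using max[OF feas'] by simp
  qed
  have "is_arg_max (\<lambda>(v, \<tau>). log_likelihood b D v \<tau>)
      (\<lambda>(v, \<tau>). v \<in> pl_utilities b L D \<and> \<tau> \<ge> 1 / c) (u, \<sigma>) \<longleftrightarrow> u = ?m \<and> \<sigma> = 1 / \<gamma>" for u \<sigma>
  proof
    assume *: "is_arg_max (\<lambda>(v, \<tau>). log_likelihood b D v \<tau>)
      (\<lambda>(v, \<tau>). v \<in> pl_utilities b L D \<and> \<tau> \<ge> 1 / c) (u, \<sigma>)"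
    then have "log_likelihood b D ?m (1 / \<gamma>) \<le> log_likelihood b D u \<sigma>"
      using m_pl m_scale by (auto simp: is_arg_max_def not_less)
    moreover have "u \<in> pl_utilities b L D" "\<sigma> \<ge> 1 / c" using * by (auto simp: is_arg_max_def)
    ultimately show "u = ?m \<and> \<sigma> = 1 / \<gamma>" using bound[of u \<sigma>] m_value by linarith
  next
    assume "u = ?m \<and> \<sigma> = 1 / \<gamma>"
    moreover have "log_likelihood b D v \<tau> \<le> log_likelihood b D ?m (1 / \<gamma>)"
      if "v \<in> pl_utilities b L D" "\<tau> \<ge> 1 / c" for v \<tau>
      using bound[OF that] m_value by simp
    ultimately show "is_arg_max (\<lambda>(v, \<tau>). log_likelihood b D v \<tau>)
      (\<lambda>(v, \<tau>). v \<in> pl_utilities b L D \<and> \<tau> \<ge> 1 / c) (u, \<sigma>)"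
      using m_pl m_scale by (auto simp: is_arg_max_def not_less)
  qed
  then show ?thesis by auto
qed

end
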